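(* Let $X$ be a separable metrizable topological group that is crowded, Baire, and countable dense homogeneous. Assume that $X$ has index $2$ in its Raĭkov completion $\varrho X$. Then $X$ contains a subspace homeomorphic to the Cantor set $2^\omega$.
   Context: Groups are not assumed to be commutative. A space is crowded if it is non-empty and has no isolated points. A space $X$ is Baire if no non-empty open subset of $X$ is meager in $X$ (a subset of $X$ is meager in $X$ if it is contained in a countable union of closed nowhere dense subsets of $X$). A space $X$ is countable dense homogeneous if for every pair $(D,E)$ of countable (i.e., at most countable) dense subsets of $X$ there exists a homeomorphism $h:X\to X$ such that $h[D]=E$. The Raĭkov completion $\varrho X$ of a topological group $X$ is its completion with respect to the two-sided uniformity, i.e., the (unique up to topological isomorphism fixing $X$) Hausdorff topological group that is complete in its two-sided uniformity and contains $X$ as a dense topological subgroup; when $X$ is separable metrizable, $\varrho X$ is a Polish group. *)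

theory Defs
  imports "HOL-Analysis.Analysis" "HOL-Algebra.Coset"
begin

definition crowded_space :: "'a topology \<Rightarrow> bool" where
  "crowded_space X \<longleftrightarrow> topspace X \<noteq> {} \<and> (\<forall>x\<in>topspace X. \<not> openin X {x})"

definition nowhere_dense_in :: "'a topology \<Rightarrow> 'a set \<Rightarrow> bool" where
  "nowhere_dense_in X A \<longleftrightarrow> A \<subseteq> topspace X \<and> X interior_of (X closure_of A) = {}"

definition meager_in :: "'a topology \<Rightarrow> 'a set \<Rightarrow> bool" where
  "meager_in X A \<longleftrightarrow>
     (\<exists>\<C>. countable \<C> \<and> (\<forall>C\<in>\<C>. closedin X C \<and> nowhere_dense_in X C) \<and> A \<subseteq> \<Union>\<C>)"

definition Baire_space :: "'a topology \<Rightarrow> bool" where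
  "Baire_space X \<longleftrightarrow> (\<forall>U. openin X U \<longrightarrow> U \<noteq> {} \<longrightarrow> \<not> meager_in X U)"

definition countable_dense_in :: "'a topology \<Rightarrow> 'a set \<Rightarrow> bool" where
  "countable_dense_in X D \<longleftrightarrow> D \<subseteq> topspace X \<and> countable D \<and> X closure_of D = topspace X"

definition countable_dense_homogeneous :: "'a topology \<Rightarrow> bool" where
  "countable_dense_homogeneous X \<longleftrightarrow>
     (\<forall>D E. countable_dense_in X D \<longrightarrow> countable_dense_in X E \<longrightarrow>
        (\<exists>h. homeomorphic_map X X h \<and> h ` D = E))"

text \<open>The Cantor set as the countable power of the two-point discrete space.\<close>

definition Cantor_topology :: "(nat \<Rightarrow> bool) topology" where
  "Cantor_topology = product_topology (\<lambda>_. discrete_topology UNIV) UNIV"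

text \<open>No separation axiom is part of the definition of a topological group.\<close>

definition topological_group :: "('a, 'm) monoid_scheme \<Rightarrow> 'a topology \<Rightarrow> bool" where
  "topological_group G T \<longleftrightarrow>
     group G \<and> topspace T = carrier G \<and>
     continuous_map (prod_topology T T) T (\<lambda>(x, y). x \<otimes>\<^bsub>G\<^esub> y) \<and>
     continuous_map T T (\<lambda>x. inv\<^bsub>G\<^esub> x)"

text \<open>
  The two-sided uniformity is the supremum of the left uniformity (entourages given by
  \<open>x\<inverse>y \<in> U\<close>) and the right uniformity (entourages given by \<open>xy\<inverse> \<in> U\<close>), where \<open>U\<close> ranges over
  the open neighbourhoods of the identity.  As in the class \<open>uniform_space\<close>, a uniformity is
  represented by its filter of entourages.
\<close>

definition two_sided_uniformity ::
    "('a, 'm) monoid_scheme \<Rightarrow> 'a topology \<Rightarrow> ('a \<times> 'a) filter" where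
  "two_sided_uniformity G T =
     (INF U\<in>{U. openin T U \<and> \<one>\<^bsub>G\<^esub> \<in> U}.
        principal {(x, y). x \<in> carrier G \<and> y \<in> carrier G \<and>
                           inv\<^bsub>G\<^esub> x \<otimes>\<^bsub>G\<^esub> y \<in> U \<and> x \<otimes>\<^bsub>G\<^esub> inv\<^bsub>G\<^esub> y \<in> U})"

text \<open>
  Completeness with respect to the two-sided uniformity: every proper Cauchy filter on the
  group converges (cf. the library constants \<open>cauchy_filter\<close> and \<open>complete\<close>, which are
  restricted to type classes).
\<close>

definition Raikov_complete :: "('a, 'm) monoid_scheme \<Rightarrow> 'a topology \<Rightarrow> bool" where
  "Raikov_complete G T \<longleftrightarrow>
     (\<forall>F. F \<le> principal (carrier G) \<longrightarrow> F \<noteq> bot \<longrightarrow> F \<times>\<^sub>F F \<le> two_sided_uniformity G T \<longrightarrow>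
        (\<exists>x\<in>carrier G. F \<le> nhdsin T x))"

text \<open>
  \<open>(R, TR)\<close> together with \<open>e\<close> is a Raikov completion of \<open>(G, T)\<close>: a Hausdorff, complete
  topological group in which \<open>e\<close> embeds \<open>G\<close> as a dense topological subgroup.  This
  determines the completion up to topological isomorphism respecting the embeddings; when
  \<open>e\<close> is the identity, \<open>G\<close> is literally a subgroup of \<open>R\<close> with the subspace topology.
\<close>

definition Raikov_completion ::
    "('a, 'm) monoid_scheme \<Rightarrow> 'a topology \<Rightarrow>
     ('b, 'n) monoid_scheme \<Rightarrow> 'b topology \<Rightarrow> ('a \<Rightarrow> 'b) \<Rightarrow> bool" where
  "Raikov_completion G T R TR e \<longleftrightarrow>
     topological_group R TR \<and> Hausdorff_space TR \<and> Raikov_complete R TR \<and>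
     e \<in> hom G R \<and> embedding_map T TR e \<and> TR closure_of (e ` carrier G) = carrier R"

end

theory Submission
  imports Defs "HOL-Algebra.Generated_Groups"
begin

text \<open>
  Regard \<open>G\<close> as a dense subgroup of index two of \<open>R\<close>, and suppose that it contains no Cantor set.
  The proof shows that the homeomorphisms of \<open>G\<close> are then too rigid for countable dense
  homogeneity.

  Let \<open>h\<close> be a homeomorphism of \<open>G\<close> and \<open>g x = x\<inverse> h x\<close> its displacement.  If \<open>g\<close> were
  constant on no non-empty open set, one could build a binary tree of non-empty open sets on which
  \<open>x\<close> and \<open>h x\<close> vary less and less in the two-sided uniformity, while the \<open>g\<close>-images of the two
  children of a node have disjoint closures.  Following a branch, \<open>x\<close> and \<open>h x\<close> converge to
  points \<open>X\<close> and \<open>Y\<close> of the completion \<open>R\<close>.  Because \<open>h\<close> and its inverse are continuous on \<open>G\<close>,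
  either both limits lie in \<open>G\<close> or neither does, and since \<open>G\<close> has index two, \<open>X\<inverse> Y\<close> lies in \<open>G\<close> in
  both cases.  So the displacements converge in \<open>G\<close> itself along every branch, and
  their limits form a Cantor set in \<open>G\<close>, a contradiction.  Hence every homeomorphism of \<open>G\<close>
  is a right translation on some non-empty open set
  (\<open>homeomorphism_locally_translation\<close>).

  On the other hand, \<open>G\<close> is uncountable, being crowded and Baire.  Take a countable
  dense subgroup \<open>D\<close>, a point \<open>p\<close> outside \<open>D\<close>, and \<open>E = D \<union> Dp\<close>.  Locally \<open>D\<close> is one coset of
  \<open>D\<close>, but \<open>E\<close> is everywhere a mixture of two; so a map carrying \<open>D\<close> onto \<open>E\<close> is a
  right translation on no non-empty open set (\<open>dense_sets_not_locally_translates\<close>).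
\<close>

section \<open>Cantor schemes\<close>

text \<open>
  The nodes of the binary tree are lists with the most recent choice at the head, so that a child of
  \<open>s\<close> is \<open>b # s\<close> and trees of sets can be defined by structural recursion.
\<close>

definition branch :: "(nat \<Rightarrow> bool) \<Rightarrow> nat \<Rightarrow> bool list" where
  "branch \<alpha> n = rev (map \<alpha> [0..<n])"

lemma branch_0 [simp]: "branch \<alpha> 0 = []"
  and branch_Suc [simp]: "branch \<alpha> (Suc n) = \<alpha> n # branch \<alpha> n"
  and length_branch [simp]: "length (branch \<alpha> n) = n"
  by (simp_all add: branch_def)

lemma branch_cong: "(\<And>k. k < n \<Longrightarrow> \<alpha> k = \<beta> k) \<Longrightarrow> branch \<alpha> n = branch \<beta> n"
  by (simp add: branch_def)

lemma branch_decreasing: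
  assumes "\<And>b s. C (b # s) \<subseteq> C s" and "m \<le> n"
  shows "C (branch \<alpha> n) \<subseteq> C (branch \<alpha> m)"
  using \<open>m \<le> n\<close> by (induction rule: dec_induct) (use assms(1) in auto)

lemma openin_Cantor_cylinder:
  "openin Cantor_topology {\<beta>. \<forall>k<n. \<beta> k = \<alpha> k}"
proof -
  let ?S = "\<lambda>k. if k < n then {\<alpha> k} else UNIV"
  have "finite {k. ?S k \<noteq> (UNIV :: bool set)}"
    by (rule finite_subset[of _ "{..<n}"]) auto
  then have "openin Cantor_topology (\<Pi>\<^sub>E k\<in>UNIV. ?S k)"
    unfolding Cantor_topology_def openin_PiE_gen by simp
  moreover have "(\<Pi>\<^sub>E k\<in>UNIV. ?S k) = {\<beta>. \<forall>k<n. \<beta> k = \<alpha> k}"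
  proof (intro equalityI subsetI)
    fix \<beta> assume "\<beta> \<in> (\<Pi>\<^sub>E k\<in>UNIV. ?S k)"
    then have "\<beta> k \<in> ?S k" for k by (rule PiE_mem) simp
    then have "\<beta> k = \<alpha> k" if "k < n" for k
      using that by (metis (full_types) singletonD)
    then show "\<beta> \<in> {\<beta>. \<forall>k<n. \<beta> k = \<alpha> k}" by blast
  qed (auto simp: PiE_UNIV_domain)
  ultimately show ?thesis by simp
qed

text \<open>
  Send a branch to a point common to the closures along it.  This map is injective because distinct
  branches separate at some node, where the closures are disjoint, and continuous because the
  sets shrink; compactness of the Cantor set makes it an embedding.  Completeness is
  replaced by the hypothesis that the closures along each branch have a common point.
\<close>

lemma (in Metric_space) Cantor_scheme:
  assumes dec: "\<And>b s. C (b # s) \<subseteq> C s"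
    and disj: "\<And>s. (mtopology closure_of C (True # s)) \<inter> (mtopology closure_of C (False # s)) = {}"
    and small: "\<And>s x y. x \<in> C s \<Longrightarrow> y \<in> C s \<Longrightarrow> d x y < inverse (Suc (length s))"
    and lim: "\<And>\<alpha>. (\<Inter>n. mtopology closure_of C (branch \<alpha> n)) \<noteq> {}"
  shows "\<exists>S\<subseteq>M. subtopology mtopology S homeomorphic_space Cantor_topology"
proof -
  have "\<forall>\<alpha>. \<exists>x. \<forall>n. x \<in> mtopology closure_of C (branch \<alpha> n)"
  proof
    fix \<alpha> show "\<exists>x. \<forall>n. x \<in> mtopology closure_of C (branch \<alpha> n)"
      using lim[of \<alpha>] by (simp add: ex_in_conv[symmetric])
  qed
  then obtain F where "\<forall>\<alpha> n. F \<alpha> \<in> mtopology closure_of C (branch \<alpha> n)"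
    by (rule choice[THEN exE])
  then have F: "\<And>\<alpha> n. F \<alpha> \<in> mtopology closure_of C (branch \<alpha> n)" by blast
  have FM: "F \<alpha> \<in> M" for \<alpha>
    using F[of \<alpha> 0] by (simp add: metric_closure_of)
  have inj: "inj F"
  proof (rule injI, rule ccontr)
    fix \<alpha> \<beta> assume eq: "F \<alpha> = F \<beta>" and "\<alpha> \<noteq> \<beta>"
    then have ex: "\<exists>n. \<alpha> n \<noteq> \<beta> n" by auto
    define n where "n = (LEAST n. \<alpha> n \<noteq> \<beta> n)"
    have n: "\<alpha> n \<noteq> \<beta> n" and less: "\<And>k. k < n \<Longrightarrow> \<alpha> k = \<beta> k"
      unfolding n_def using LeastI_ex[OF ex] not_less_Least by blast+
    have br: "branch \<alpha> n = branch \<beta> n" using less by (rule branch_cong)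
    show False
      using F[of \<alpha> "Suc n"] F[of \<beta> "Suc n"] disj[of "branch \<beta> n"] n eq br
      by (cases "\<alpha> n"; cases "\<beta> n") auto
  qed
  have near: "d (F \<alpha>) (F \<beta>) < 3 * inverse (Suc n)" if "\<And>k. k < n \<Longrightarrow> \<beta> k = \<alpha> k" for \<alpha> \<beta> n
  proof -
    have pos: "0 < inverse (real (Suc n))" by simp
    have br: "branch \<beta> n = branch \<alpha> n" using that by (rule branch_cong)
    obtain x where x: "x \<in> C (branch \<alpha> n)" "x \<in> mball (F \<alpha>) (inverse (Suc n))"
      using F[of \<alpha> n] pos unfolding metric_closure_of by blast
    obtain y where y: "y \<in> C (branch \<alpha> n)" "y \<in> mball (F \<beta>) (inverse (Suc n))"
      using F[of \<beta> n] pos unfolding metric_closure_of br by blast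
    have "d x y < inverse (Suc n)" using small[OF x(1) y(1)] by simp
    then show ?thesis
      using x y triangle[of "F \<alpha>" x "F \<beta>"] triangle[of x y "F \<beta>"] commute[of "F \<beta>" y] FM
      by auto
  qed
  have topC: "topspace Cantor_topology = UNIV"
    by (simp add: Cantor_topology_def)
  have cont: "continuous_map Cantor_topology mtopology F"
    unfolding continuous_map_to_metric
  proof (intro ballI allI impI)
    fix \<alpha> and \<epsilon> :: real assume "0 < \<epsilon>"
    then obtain n where n: "inverse (real (Suc n)) < \<epsilon> / 3"
      using reals_Archimedean[of "\<epsilon> / 3"] by auto
    show "\<exists>U. openin Cantor_topology U \<and> \<alpha> \<in> U \<and> (\<forall>\<beta>\<in>U. F \<beta> \<in> mball (F \<alpha>) \<epsilon>)"
    proof (intro exI conjI ballI)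
      show "openin Cantor_topology {\<beta>. \<forall>k<n. \<beta> k = \<alpha> k}" by (rule openin_Cantor_cylinder)
      fix \<beta> assume "\<beta> \<in> {\<beta>. \<forall>k<n. \<beta> k = \<alpha> k}"
      then show "F \<beta> \<in> mball (F \<alpha>) \<epsilon>" using near[of n \<beta> \<alpha>] n FM by auto
    qed auto
  qed
  have "compact_space Cantor_topology"
    by (simp add: Cantor_topology_def compact_space_product_topology compact_space_discrete_topology)
  then have "closed_map Cantor_topology mtopology F"
    using cont Hausdorff_space_mtopology by (blast intro: T1_Spaces.continuous_imp_closed_map)
  then have "embedding_map Cantor_topology mtopology F"
    using cont inj by (intro injective_closed_imp_embedding_map) (auto simp: topC)
  then have "Cantor_topology homeomorphic_space subtopology mtopology (range F)"
    using embedding_map_imp_homeomorphic_space topC by metis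
  moreover have "range F \<subseteq> M" using FM by auto
  ultimately show ?thesis using homeomorphic_space_sym by blast
qed

section \<open>General facts on topological spaces\<close>

lemma limitin_embedding_map_iff:
  assumes e: "embedding_map X Y e" and a: "a \<in> topspace X"
    and ev: "\<forall>\<^sub>F n in F. f n \<in> topspace X"
  shows "limitin Y (e \<circ> f) (e a) F \<longleftrightarrow> limitin X f a F"
proof
  assume "limitin X f a F"
  then show "limitin Y (e \<circ> f) (e a) F"
    using e unfolding embedding_map_def
    by (metis continuous_map_in_subtopology continuous_map_limit homeomorphic_imp_continuous_map)
next
  assume L: "limitin Y (e \<circ> f) (e a) F"
  have hom: "homeomorphic_map X (subtopology Y (e ` topspace X)) e"
    using e by (simp add: embedding_map_def)
  show "limitin X f a F"
    unfolding limitin_def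
  proof (intro conjI allI impI a)
    fix U assume U: "openin X U \<and> a \<in> U"
    then have "openin (subtopology Y (e ` topspace X)) (e ` U)"
      using hom homeomorphic_imp_open_map open_map_def by blast
    then obtain V where V: "openin Y V" "e ` U = V \<inter> e ` topspace X"
      by (auto simp: openin_subtopology)
    then have "\<forall>\<^sub>F n in F. e (f n) \<in> V"
      using L U by (auto simp: limitin_def)
    then show "\<forall>\<^sub>F n in F. f n \<in> U"
      using ev
    proof eventually_elim
      case (elim n)
      then have "e (f n) \<in> e ` U" using V by blast
      then show ?case
        using elim U openin_subset[of X U] homeomorphic_imp_injective_map[OF hom]
        by (auto dest: inj_onD)
    qed
  qed
qed

lemma continuous_map_near_diagonal:
  assumes "continuous_map (prod_topology X X) Y f" "a \<in> topspace X" "openin Y W" "f (a, a) \<in> W"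
  obtains U where "openin X U" "a \<in> U" "\<And>x y. x \<in> U \<Longrightarrow> y \<in> U \<Longrightarrow> f (x, y) \<in> W"
proof -
  let ?P = "{p \<in> topspace (prod_topology X X). f p \<in> W}"
  have "openin (prod_topology X X) ?P"
    using assms(1,3) by (rule openin_continuous_map_preimage)
  moreover have "(a, a) \<in> ?P" using assms by simp
  ultimately obtain U V where "openin X U" "openin X V" "a \<in> U" "a \<in> V" "U \<times> V \<subseteq> ?P"
    unfolding openin_prod_topology_alt by meson
  then show thesis
    by (intro that[of "U \<inter> V"]) auto
qed

text \<open>
  In a crowded \<open>T\<^sub>1\<close> space singletons are closed and nowhere dense, so a countable one is meager in
  itself.
\<close>

lemma crowded_Baire_uncountable:
  assumes "crowded_space X" "Baire_space X" "t1_space X"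
  shows "uncountable (topspace X)"
proof
  assume cnt: "countable (topspace X)"
  let ?C = "(\<lambda>x. {x}) ` topspace X"
  have "closedin X {x} \<and> nowhere_dense_in X {x}" if "x \<in> topspace X" for x
  proof -
    have cl: "closedin X {x}" using assms(3) that by (simp add: t1_space_closedin_singleton)
    have "X interior_of {x} \<noteq> {x}"
      using assms(1) that unfolding crowded_space_def by (metis openin_interior_of)
    then have "X interior_of {x} = {}"
      using interior_of_subset[of X "{x}"] by blast
    with cl that show ?thesis by (simp add: nowhere_dense_in_def closure_of_closedin)
  qed
  then have "meager_in X (topspace X)"
    unfolding meager_in_def using cnt by (intro exI[of _ ?C]) auto
  then show False
    using assms(1,2) by (auto simp: Baire_space_def crowded_space_def)
qed


section \<open>Groups and topological groups\<close>

text \<open>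
  The elements outside \<open>H\<close> and their inverses all lie in the single other coset.
\<close>

lemma (in group) index_two_quotient_mem:
  assumes H: "subgroup H G" and card: "card (rcosets H) = 2"
    and x: "x \<in> carrier G" "x \<notin> H" and y: "y \<in> carrier G" "y \<notin> H"
  shows "inv x \<otimes> y \<in> H"
proof -
  have noncoset: "H #> inv z \<in> rcosets H - {H}" if "z \<in> carrier G" "z \<notin> H" for z
    using that H rcos_self[of "inv z" H] subgroup.m_inv_closed[OF H, of "inv z"] subgroup.subset[OF H]
    by (auto intro!: rcosetsI)
  have "H \<in> rcosets H"
    using H subgroup.rcosets_non_empty coset_join2[of \<one> H] rcosetsI[of H \<one>] subgroup.subset[OF H]
      subgroup.one_closed[OF H] by auto
  then have "card (rcosets H - {H}) = 1"
    using card by simp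
  then have "H #> inv x = H #> inv y"
    using noncoset[OF x] noncoset[OF y] by (metis card_1_singletonE singletonD)
  then have "inv x \<in> H #> inv y"
    using rcos_self[of "inv x" H] x H by simp
  then obtain k where k: "k \<in> H" "inv x = k \<otimes> inv y"
    by (auto simp: r_coset_def)
  then have "inv x \<otimes> y = k"
    using y subgroup.mem_carrier[OF H] by (simp add: m_assoc)
  with k show ?thesis by simp
qed

text \<open>
  Every element of the generated subgroup is the value of a word in the generators and their inverses.
\<close>

lemma (in group) countable_generate:
  assumes "countable A" "A \<subseteq> carrier G"
  shows "countable (generate G A)"
proof -
  let ?L = "lists (A \<union> (\<lambda>a. inv a) ` A)"
  let ?w = "\<lambda>xs. foldr (\<otimes>) xs \<one>"
  have closed: "?w xs \<in> carrier G" if "xs \<in> ?L" for xs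
    using that assms(2) by (induction xs) auto
  have app: "?w (xs @ ys) = ?w xs \<otimes> ?w ys" if "xs \<in> ?L" "ys \<in> ?L" for xs ys
    using that(1)
  proof (induction xs)
    case Nil then show ?case using closed[OF that(2)] by simp
  next
    case (Cons a xs)
    then show ?case using closed[of xs] closed[OF that(2)] assms(2) by (auto simp: m_assoc)
  qed
  have "x \<in> ?w ` ?L" if "x \<in> generate G A" for x
    using that
  proof (induction rule: generate.induct)
    case one then show ?case by (intro image_eqI[of _ _ "[]"]) auto
  next
    case (incl h) then show ?case using assms(2) by (intro image_eqI[of _ _ "[h]"]) auto
  next
    case (inv h) then show ?case using assms(2) by (intro image_eqI[of _ _ "[inv h]"]) auto
  next
    case (eng h1 h2)
    then obtain xs ys where "xs \<in> ?L" "ys \<in> ?L" "h1 = ?w xs" "h2 = ?w ys" by blast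
    then show ?case using app[of xs ys] by (intro image_eqI[of _ _ "xs @ ys"]) auto
  qed
  then have "generate G A \<subseteq> ?w ` ?L" by blast
  moreover have "countable (?w ` ?L)"
    using assms(1) by (intro countable_image countable_lists) simp
  ultimately show ?thesis by (rule countable_subset)
qed

lemma topological_group_continuous_ops:
  assumes tg: "topological_group G T" and f: "continuous_map X T f" and g: "continuous_map X T g"
  shows "continuous_map X T (\<lambda>x. inv\<^bsub>G\<^esub> f x \<otimes>\<^bsub>G\<^esub> g x)"
    and "continuous_map X T (\<lambda>x. f x \<otimes>\<^bsub>G\<^esub> inv\<^bsub>G\<^esub> g x)"
    and "continuous_map X T (\<lambda>x. f x \<otimes>\<^bsub>G\<^esub> g x)"
proof -
  have mult: "continuous_map X T (\<lambda>x. f x \<otimes>\<^bsub>G\<^esub> g x)"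
    if "continuous_map X T f" "continuous_map X T g" for f g
  proof -
    have "continuous_map X (prod_topology T T) (\<lambda>x. (f x, g x))"
      using that by (simp add: continuous_map_paired)
    then have "continuous_map X T ((\<lambda>(x, y). x \<otimes>\<^bsub>G\<^esub> y) \<circ> (\<lambda>x. (f x, g x)))"
      using tg unfolding topological_group_def by (blast intro: continuous_map_compose)
    then show ?thesis by (simp add: o_def)
  qed
  have inv: "continuous_map X T (\<lambda>x. inv\<^bsub>G\<^esub> f x)" if "continuous_map X T f" for f
    using continuous_map_compose[OF that, of T "\<lambda>x. inv\<^bsub>G\<^esub> x"] tg
    by (simp add: topological_group_def o_def)
  show "continuous_map X T (\<lambda>x. inv\<^bsub>G\<^esub> f x \<otimes>\<^bsub>G\<^esub> g x)"
    and "continuous_map X T (\<lambda>x. f x \<otimes>\<^bsub>G\<^esub> inv\<^bsub>G\<^esub> g x)"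
    and "continuous_map X T (\<lambda>x. f x \<otimes>\<^bsub>G\<^esub> g x)"
    using mult inv f g by blast+
qed

text \<open>
  The neighbourhoods of the identity in \<open>R\<close> pull back to neighbourhoods of the identity in \<open>G\<close>, so
  a Cauchy sequence of \<open>G\<close> generates a Cauchy filter on \<open>R\<close>.
\<close>

lemma Raikov_completion_Cauchy_limit:
  assumes tg: "topological_group G T" and rc: "Raikov_completion G T R TR e"
    and x: "range x \<subseteq> carrier G"
    and Cauchy: "\<And>V. openin T V \<Longrightarrow> \<one>\<^bsub>G\<^esub> \<in> V \<Longrightarrow>
      \<exists>N. \<forall>m\<ge>N. \<forall>n\<ge>N. inv\<^bsub>G\<^esub> x m \<otimes>\<^bsub>G\<^esub> x n \<in> V \<and> x m \<otimes>\<^bsub>G\<^esub> inv\<^bsub>G\<^esub> x n \<in> V"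
  obtains z where "z \<in> carrier R" "limitin TR (e \<circ> x) z sequentially"
proof -
  have grp: "group G" "group R" and hom: "e \<in> hom G R"
    and top: "topspace T = carrier G" "topspace TR = carrier R"
    using tg rc by (auto simp: topological_group_def Raikov_completion_def)
  interpret group_hom G R e
    using grp hom by (simp add: group_hom_def group_hom_axioms_def)
  have conte: "continuous_map T TR e"
    using rc unfolding Raikov_completion_def embedding_map_def
    by (metis continuous_map_in_subtopology homeomorphic_imp_continuous_map)
  have xG: "x n \<in> carrier G" for n using x by auto
  let ?F = "filtermap (e \<circ> x) sequentially"
  have "?F \<times>\<^sub>F ?F \<le> two_sided_uniformity R TR"
    unfolding two_sided_uniformity_def
  proof (rule INF_greatest)
    fix U assume "U \<in> {U. openin TR U \<and> \<one>\<^bsub>R\<^esub> \<in> U}"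
    then have U: "openin TR U" "\<one>\<^bsub>R\<^esub> \<in> U" by auto
    let ?V = "{a \<in> topspace T. e a \<in> U}"
    have "openin T ?V" using conte U(1) by (rule openin_continuous_map_preimage)
    moreover have "\<one>\<^bsub>G\<^esub> \<in> ?V" using U top by simp
    ultimately obtain N where N: "\<And>m n. m \<ge> N \<Longrightarrow> n \<ge> N \<Longrightarrow>
        inv\<^bsub>G\<^esub> x m \<otimes>\<^bsub>G\<^esub> x n \<in> ?V \<and> x m \<otimes>\<^bsub>G\<^esub> inv\<^bsub>G\<^esub> x n \<in> ?V"
      using Cauchy by meson
    let ?P = "\<lambda>z. \<exists>n\<ge>N. z = e (x n)"
    have ev: "eventually ?P ?F"
      unfolding eventually_filtermap using eventually_ge_at_top[of N]
      by eventually_elim auto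
    show "?F \<times>\<^sub>F ?F \<le> principal {(a, b). a \<in> carrier R \<and> b \<in> carrier R \<and>
        inv\<^bsub>R\<^esub> a \<otimes>\<^bsub>R\<^esub> b \<in> U \<and> a \<otimes>\<^bsub>R\<^esub> inv\<^bsub>R\<^esub> b \<in> U}"
      unfolding le_principal eventually_prod_filter
    proof (intro exI conjI allI impI)
      show "eventually ?P ?F" "eventually ?P ?F" by (fact ev)+
      fix a b assume "?P a" "?P b"
      then obtain m n where "m \<ge> N" "n \<ge> N" and [simp]: "a = e (x m)" "b = e (x n)" by auto
      then have "e (inv\<^bsub>G\<^esub> x m \<otimes>\<^bsub>G\<^esub> x n) \<in> U" "e (x m \<otimes>\<^bsub>G\<^esub> inv\<^bsub>G\<^esub> x n) \<in> U"
        using N by auto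
      then show "(a, b) \<in> {(a, b). a \<in> carrier R \<and> b \<in> carrier R \<and>
        inv\<^bsub>R\<^esub> a \<otimes>\<^bsub>R\<^esub> b \<in> U \<and> a \<otimes>\<^bsub>R\<^esub> inv\<^bsub>R\<^esub> b \<in> U}"
        using xG by simp
    qed
  qed
  moreover have "?F \<le> principal (carrier R)"
    unfolding le_principal eventually_filtermap using xG by simp
  moreover have "?F \<noteq> bot" by (simp add: filtermap_bot_iff)
  ultimately obtain z where z: "z \<in> carrier R" "?F \<le> nhdsin TR z"
    using rc unfolding Raikov_completion_def Raikov_complete_def by blast
  have "limitin TR (e \<circ> x) z sequentially"
    unfolding limitin_def
  proof (intro conjI allI impI)
    show "z \<in> topspace TR" using z top by simp
    fix U assume "openin TR U \<and> z \<in> U"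
    then have "eventually (\<lambda>a. a \<in> U) (nhdsin TR z)" by (auto simp: eventually_nhdsin)
    then have "eventually (\<lambda>a. a \<in> U) ?F" using z(2) by (simp add: le_filter_def)
    then show "\<forall>\<^sub>F n in sequentially. (e \<circ> x) n \<in> U" by (simp add: eventually_filtermap)
  qed
  with z(1) that show thesis by blast
qed

section \<open>Dense sets that no local translation matches\<close>

text \<open>
  With \<open>E = D \<union> Dp\<close> as in the introduction, suppose that \<open>h\<close> maps \<open>D\<close> onto \<open>E\<close> and is right
  translation by \<open>q\<close> on \<open>U\<close>.  Then \<open>E\<close> agrees with \<open>Dq\<close> on the open set \<open>h ` U\<close>, and \<open>q\<close>
  lies in \<open>D\<close> or in \<open>Dp\<close>.  So \<open>Dq\<close> is one of the disjoint cosets \<open>D\<close> and \<open>Dp\<close>,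
  although both, being dense, meet \<open>h ` U\<close>.
\<close>

lemma dense_sets_not_locally_translates:
  fixes G (structure)
  assumes tg: "topological_group G T" and sep: "separable_space T"
    and unc: "uncountable (carrier G)"
  obtains D E where "countable_dense_in T D" "countable_dense_in T E"
    "\<And>h U q. homeomorphic_map T T h \<Longrightarrow> h ` D = E \<Longrightarrow> openin T U \<Longrightarrow> U \<noteq> {} \<Longrightarrow> q \<in> carrier G \<Longrightarrow>
      \<exists>x\<in>U. h x \<noteq> x \<otimes>\<^bsub>G\<^esub> q"
proof -
  have grp: "group G" and top: "topspace T = carrier G"
    using tg by (auto simp: topological_group_def)
  interpret group G by (fact grp)
  obtain C where C: "countable C" "C \<subseteq> carrier G" "T closure_of C = carrier G"
    using sep top by (auto simp: separable_space_def)
  define D where "D = generate G C"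
  have sub: "subgroup D G" unfolding D_def using C(2) by (rule generate_is_subgroup)
  have DG: "D \<subseteq> carrier G" using sub by (rule subgroup.subset)
  have "countable D" unfolding D_def using C by (intro countable_generate) auto
  have "C \<subseteq> D" unfolding D_def by (auto intro: generate.incl)
  then have clD: "T closure_of D = carrier G"
    using C(3) closure_of_mono[of C D T] closure_of_subset_topspace[of T D] top by auto
  have meetsD: "\<exists>d\<in>D. d \<in> U" if "openin T U" "U \<noteq> {}" for U
    using that clD top dense_intersects_open[of T D] by blast
  obtain p where p: "p \<in> carrier G" "p \<notin> D"
    using unc \<open>countable D\<close> DG countable_subset[of "carrier G" D] by blast
  define Dp where "Dp = (\<lambda>d. d \<otimes> p) ` D"
  have DpG: "Dp \<subseteq> carrier G" using DG p by (auto simp: Dp_def)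
  have meetsDp: "\<exists>d\<in>D. d \<otimes> p \<in> U" if U: "openin T U" "U \<noteq> {}" for U
  proof -
    let ?V = "{x \<in> topspace T. x \<otimes> p \<in> U}"
    obtain u where u: "u \<in> U" "u \<in> carrier G" using U openin_subset[of T U] top by blast
    have "continuous_map T T (\<lambda>x. x \<otimes> p)"
      using topological_group_continuous_ops(3)[OF tg, of T "\<lambda>x. x" "\<lambda>x. p"] p top by simp
    then have "openin T ?V" using U(1) by (rule openin_continuous_map_preimage)
    moreover have "u \<otimes> inv p \<in> ?V" using u p top by (simp add: m_assoc)
    ultimately show ?thesis using meetsD[of ?V] by blast
  qed
  show thesis
  proof (rule that[of D "D \<union> Dp"])
    show "countable_dense_in T D"
      using DG \<open>countable D\<close> clD top by (simp add: countable_dense_in_def)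
    have "T closure_of (D \<union> Dp) = carrier G"
      using clD closure_of_mono[of D "D \<union> Dp" T] closure_of_subset_topspace[of T "D \<union> Dp"] top by auto
    then show "countable_dense_in T (D \<union> Dp)"
      using DG DpG \<open>countable D\<close> top by (simp add: countable_dense_in_def Dp_def)
  next
    fix h U q
    assume h: "homeomorphic_map T T h" "h ` D = D \<union> Dp"
      and U: "openin T U" "U \<noteq> {}" and q: "q \<in> carrier G"
    have UG: "U \<subseteq> carrier G" using U(1) openin_subset top by blast
    show "\<exists>x\<in>U. h x \<noteq> x \<otimes> q"
    proof (rule ccontr)
      assume "\<not> ?thesis"
      then have tr: "h x = x \<otimes> q" if "x \<in> U" for x using that by blast
      have open_hU: "openin T (h ` U)" "h ` U \<noteq> {}"
        using h(1) U homeomorphic_imp_open_map unfolding open_map_def by blast+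
      \<comment> \<open>By injectivity of \<open>h\<close>, a point of \<open>E\<close> that comes from \<open>U\<close> comes from \<open>U \<inter> D\<close>,
        so that on \<open>h ` U\<close> the set \<open>E\<close> lies in \<open>Dq\<close>.\<close>
      have to_D: "\<exists>u\<in>U \<inter> D. y = u \<otimes> q" if y: "y \<in> h ` U" "y \<in> D \<union> Dp" for y
      proof -
        obtain u where u: "u \<in> U" "y = h u" using y(1) by blast
        obtain c where c: "c \<in> D" "y = h c" using y(2) h(2) by blast
        have "u = c"
          using homeomorphic_imp_injective_map[OF h(1)] u c UG DG top by (auto dest: inj_onD)
        then show ?thesis using u c tr by auto
      qed
      obtain d where d: "d \<in> D" "d \<in> U" using meetsD[OF U] by blast
      then have dq: "d \<otimes> q \<in> D \<union> Dp" using tr[OF d(2)] h(2)[symmetric] by (metis image_eqI)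
      have "q = inv d \<otimes> (d \<otimes> q)"
        using d DG q by (simp add: m_assoc[symmetric] subset_iff)
      have invd: "inv d \<in> D" using sub d(1) by (rule subgroup.m_inv_closed)
      from dq consider "q \<in> D" | d' where "d' \<in> D" "q = d' \<otimes> p"
      proof (elim UnE)
        assume "d \<otimes> q \<in> Dp"
        then obtain c where c: "c \<in> D" "d \<otimes> q = c \<otimes> p" unfolding Dp_def by blast
        have "inv d \<otimes> (c \<otimes> p) = (inv d \<otimes> c) \<otimes> p"
          using c(1) invd DG p by (simp add: m_assoc subset_iff)
        then show thesis
          using that(2)[of "inv d \<otimes> c"] subgroup.m_closed[OF sub invd c(1)]
            \<open>q = inv d \<otimes> (d \<otimes> q)\<close> c(2) by simp
      next
        assume "d \<otimes> q \<in> D"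
        then show thesis
          using that(1) subgroup.m_closed[OF sub invd] \<open>q = inv d \<otimes> (d \<otimes> q)\<close> by metis
      qed
      then show False
      proof cases
        case 1
        obtain c where c: "c \<in> D" "c \<otimes> p \<in> h ` U" using meetsDp[OF open_hU] by blast
        then obtain u where u: "u \<in> D" "c \<otimes> p = u \<otimes> q" using to_D unfolding Dp_def by blast
        then have "c \<otimes> p \<in> D" using 1 sub by (simp add: subgroup.m_closed)
        then have "inv c \<otimes> (c \<otimes> p) \<in> D"
          using c sub by (meson subgroup.m_closed subgroup.m_inv_closed)
        then show False using c p DG by (simp add: m_assoc[symmetric] subset_iff)
      next
        case (2 d')
        obtain y where y: "y \<in> D" "y \<in> h ` U" using meetsD[OF open_hU] by blast
        then obtain u where u: "u \<in> D" "y = u \<otimes> q" using to_D by blast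
        then have "y = (u \<otimes> d') \<otimes> p" using 2 p DG by (simp add: m_assoc subset_iff)
        moreover have ud: "u \<otimes> d' \<in> D" using u 2 sub by (simp add: subgroup.m_closed)
        ultimately have "inv (u \<otimes> d') \<otimes> y = p"
          using p DG by (simp add: m_assoc[symmetric] subset_iff)
        moreover have "inv (u \<otimes> d') \<otimes> y \<in> D"
          using ud y sub by (meson subgroup.m_closed subgroup.m_inv_closed)
        ultimately show False using p by simp
      qed
    qed
  qed
qed


section \<open>Homeomorphisms are translations on an open set\<close>

text \<open>
  This is the Cantor scheme argument of the introduction.  The tree of open sets is \<open>u\<close>, and
  the scheme consists of the images \<open>g ` u s\<close> under the displacement \<open>g\<close>.  Index two enters
  through \<open>index_two_quotient_mem\<close>: it keeps the limit of \<open>g\<close> along a branch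
  inside \<open>G\<close> even when the branch itself converges to a point outside.
\<close>

lemma homeomorphism_locally_translation:
  fixes G (structure)
  assumes tg: "topological_group G T" and met: "metrizable_space T"
    and rc: "Raikov_completion G T R TR e"
    and index: "card (rcosets\<^bsub>R\<^esub> (e ` carrier G)) = 2"
    and noCantor: "\<not> (\<exists>S\<subseteq>topspace T. subtopology T S homeomorphic_space Cantor_topology)"
    and hom: "homeomorphic_map T T h"
  obtains U q where "openin T U" "U \<noteq> {}" "q \<in> carrier G" "\<And>x. x \<in> U \<Longrightarrow> h x = x \<otimes> q"
proof (rule ccontr)
  note witnesses = that
  assume contra: "\<not> thesis"
  have top: "topspace T = carrier G" "topspace TR = carrier R" and grp: "group G" "group R"
    and ehom: "e \<in> hom G R" and tgR: "topological_group R TR" and HdR: "Hausdorff_space TR"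
    and emb: "embedding_map T TR e"
    using tg rc by (auto simp: topological_group_def Raikov_completion_def)
  interpret group_hom G R e
    using grp ehom by (simp add: group_hom_def group_hom_axioms_def)
  obtain M d where Md: "Metric_space M d" "T = Metric_space.mtopology M d"
    using met by (auto simp: metrizable_space_def)
  interpret Metric_space M d by (fact Md)
  note T = Md(2)
  have M: "M = carrier G" using top T by simp
  obtain k where k: "homeomorphic_maps T T h k"
    using hom by (auto simp: homeomorphic_map_maps)
  have conth: "continuous_map T T h" and contk: "continuous_map T T k"
    and kh: "\<And>x. x \<in> carrier G \<Longrightarrow> k (h x) = x"
    using k top by (auto simp: homeomorphic_maps_def)
  have hG: "h x \<in> carrier G" if "x \<in> carrier G" for x
    using conth that top by (auto simp: continuous_map_def)
  define g where "g x = inv x \<otimes> h x" for x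
  have gG: "g x \<in> carrier G" if "x \<in> carrier G" for x using that hG by (simp add: g_def)
  have gM: "g x \<in> M" if "x \<in> carrier G" for x using gG[OF that] M by simp
  have contg: "continuous_map T T g"
    unfolding g_def using topological_group_continuous_ops(1)[OF tg, of T "\<lambda>x. x" h] conth by simp
  have nonconst: "\<exists>a\<in>U. \<exists>b\<in>U. g a \<noteq> g b" if U: "openin T U" "U \<noteq> {}" for U
  proof (rule ccontr)
    assume const: "\<not> ?thesis"
    obtain a where a: "a \<in> U" using U by blast
    have UG: "U \<subseteq> carrier G" using U(1) openin_subset top by blast
    have "h x = x \<otimes> g a" if "x \<in> U" for x
    proof -
      have x: "x \<in> carrier G" using that UG by blast
      have "x \<otimes> g x = (x \<otimes> inv x) \<otimes> h x"
        unfolding g_def using x hG[OF x] by (intro G.m_assoc[symmetric]) auto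
      also have "\<dots> = h x" using x hG[OF x] by simp
      finally show ?thesis using const a that by metis
    qed
    then show False using contra witnesses[OF U, of "g a"] gG a UG by blast
  qed
  define V where "V n = mball \<one> (inverse (real (Suc n)))" for n
  have V: "openin T (V n)" "\<one> \<in> V n" for n
    using G.one_closed unfolding V_def T M[symmetric] by (auto simp del: of_nat_Suc)
  \<comment> \<open>The first four conditions make \<open>x\<close> and \<open>h x\<close> Cauchy along a branch in the two-sided
    uniformity; the last one makes the displacement sets of the scheme shrink.\<close>
  define small where "small n U \<longleftrightarrow> (\<forall>x\<in>U. \<forall>y\<in>U.
      inv x \<otimes> y \<in> V n \<and> x \<otimes> inv y \<in> V n \<and> inv h x \<otimes> h y \<in> V n \<and> h x \<otimes> inv h y \<in> V n \<and>
      d (g x) (g y) < inverse (real (Suc n)))" for n U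
  have small_nhd: "\<exists>U. openin T U \<and> a \<in> U \<and> U \<subseteq> W \<and> small n U" if W: "openin T W" "a \<in> W" for a W n
  proof -
    have a: "a \<in> carrier G" using W openin_subset top by blast
    let ?TT = "prod_topology T T"
    have f: "continuous_map ?TT T fst" "continuous_map ?TT T snd"
      by (rule continuous_map_fst continuous_map_snd)+
    have hf: "continuous_map ?TT T (\<lambda>p. h (fst p))" "continuous_map ?TT T (\<lambda>p. h (snd p))"
      using continuous_map_compose[OF f(1) conth] continuous_map_compose[OF f(2) conth]
      by (simp_all add: o_def)
    note ops = topological_group_continuous_ops(1,2)[OF tg]
    obtain U1 where U1: "openin T U1" "a \<in> U1" "\<And>x y. x \<in> U1 \<Longrightarrow> y \<in> U1 \<Longrightarrow> inv x \<otimes> y \<in> V n"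
      using continuous_map_near_diagonal[OF ops(1)[OF f], of a "V n"] a V top by auto
    obtain U2 where U2: "openin T U2" "a \<in> U2" "\<And>x y. x \<in> U2 \<Longrightarrow> y \<in> U2 \<Longrightarrow> x \<otimes> inv y \<in> V n"
      using continuous_map_near_diagonal[OF ops(2)[OF f], of a "V n"] a V top by auto
    obtain U3 where U3: "openin T U3" "a \<in> U3" "\<And>x y. x \<in> U3 \<Longrightarrow> y \<in> U3 \<Longrightarrow> inv h x \<otimes> h y \<in> V n"
      using continuous_map_near_diagonal[OF ops(1)[OF hf], of a "V n"] a V top hG by auto
    obtain U4 where U4: "openin T U4" "a \<in> U4" "\<And>x y. x \<in> U4 \<Longrightarrow> y \<in> U4 \<Longrightarrow> h x \<otimes> inv h y \<in> V n"
      using continuous_map_near_diagonal[OF ops(2)[OF hf], of a "V n"] a V top hG by auto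
    define \<epsilon> where "\<epsilon> = inverse (real (Suc n)) / 2"
    have \<epsilon>: "0 < \<epsilon>" "inverse (real (Suc n)) = \<epsilon> + \<epsilon>" by (simp_all add: \<epsilon>_def)
    define U5 where "U5 = {x \<in> topspace T. g x \<in> mball (g a) \<epsilon>}"
    have U5: "openin T U5" "a \<in> U5"
    proof -
      show "openin T U5"
        unfolding U5_def by (rule openin_continuous_map_preimage[OF contg]) (simp add: T)
      show "a \<in> U5" using a gM[OF a] \<epsilon>(1) top(1) by (simp add: U5_def)
    qed
    have U5d: "d (g x) (g y) < inverse (real (Suc n))" if "x \<in> U5" "y \<in> U5" for x y
    proof -
      have "d (g a) (g x) < \<epsilon>" "d (g a) (g y) < \<epsilon>" "g x \<in> M" "g y \<in> M" "g a \<in> M"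
        using that by (auto simp: U5_def)
      then show ?thesis unfolding \<epsilon>(2) using triangle[of "g x" "g a" "g y"] commute[of "g a" "g x"] by simp
    qed
    show ?thesis
    proof (intro exI conjI)
      show "openin T (W \<inter> U1 \<inter> U2 \<inter> U3 \<inter> U4 \<inter> U5)"
        using W U1 U2 U3 U4 U5 by (intro openin_Int)
      show "small n (W \<inter> U1 \<inter> U2 \<inter> U3 \<inter> U4 \<inter> U5)"
        unfolding small_def using U1(3) U2(3) U3(3) U4(3) U5d by simp
    qed (use W U1 U2 U3 U4 U5 in auto)
  qed
  define good where "good U \<longleftrightarrow> openin T U \<and> U \<noteq> {}" for U
  \<comment> \<open>Two points with different displacements give two small open subsets whose displacements stay in
    disjoint closed balls.\<close>
  have split: "\<exists>K. (\<forall>b. good (K b) \<and> K b \<subseteq> U \<and> small n (K b)) \<and>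
      (T closure_of g ` K True) \<inter> (T closure_of g ` K False) = {}" if U: "good U" for U n
  proof -
    obtain a b where ab: "a \<in> U" "b \<in> U" "g a \<noteq> g b"
      using nonconst[of U] U unfolding good_def by blast
    have abG: "a \<in> carrier G" "b \<in> carrier G"
      using ab U openin_subset[of T U] top(1) unfolding good_def by blast+
    define \<delta> where "\<delta> = d (g a) (g b) / 3"
    have \<delta>: "0 < \<delta>" using ab(3) gM[OF abG(1)] gM[OF abG(2)] by (simp add: \<delta>_def)
    have near: "\<exists>W. good W \<and> W \<subseteq> U \<and> small n W \<and> T closure_of g ` W \<subseteq> mcball (g c) \<delta>"
      if c: "c \<in> U" "c \<in> carrier G" for c
    proof -
      have "openin T {x \<in> topspace T. g x \<in> mball (g c) \<delta>}"
        by (rule openin_continuous_map_preimage[OF contg]) (simp add: T)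
      then have "openin T (U \<inter> {x \<in> topspace T. g x \<in> mball (g c) \<delta>})"
        using U unfolding good_def by blast
      then obtain W where W: "openin T W" "c \<in> W" "W \<subseteq> U \<inter> {x \<in> topspace T. g x \<in> mball (g c) \<delta>}" "small n W"
        using small_nhd[of "U \<inter> {x \<in> topspace T. g x \<in> mball (g c) \<delta>}" c n] c \<delta> gM[OF c(2)] top(1) by auto
      then have "g ` W \<subseteq> mcball (g c) \<delta>" by (auto simp: less_imp_le)
      then have "T closure_of g ` W \<subseteq> mcball (g c) \<delta>"
        by (intro closure_of_minimal) (auto simp: T)
      with W show ?thesis unfolding good_def by blast
    qed
    obtain W1 where W1: "good W1" "W1 \<subseteq> U" "small n W1" "T closure_of g ` W1 \<subseteq> mcball (g a) \<delta>"
      using near ab(1) abG(1) by blast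
    obtain W2 where W2: "good W2" "W2 \<subseteq> U" "small n W2" "T closure_of g ` W2 \<subseteq> mcball (g b) \<delta>"
      using near ab(2) abG(2) by blast
    have "mcball (g a) \<delta> \<inter> mcball (g b) \<delta> = {}"
    proof (intro equals0I)
      fix c assume "c \<in> mcball (g a) \<delta> \<inter> mcball (g b) \<delta>"
      then have "g a \<in> M" "g b \<in> M" "c \<in> M" "d (g a) c \<le> \<delta>" "d (g b) c \<le> \<delta>" by auto
      moreover have "d (g a) (g b) = 3 * \<delta>" by (simp add: \<delta>_def)
      ultimately show False
        using \<delta> triangle[of "g a" c "g b"] commute[of c "g b"] by linarith
    qed
    then show ?thesis
      using W1 W2 by (intro exI[of _ "\<lambda>b. if b then W1 else W2"]) auto
  qed
  then have "\<forall>p. \<exists>K. good (snd p) \<longrightarrow> (\<forall>b. good (K b) \<and> K b \<subseteq> snd p \<and> small (fst p) (K b)) \<and>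
      (T closure_of g ` K True) \<inter> (T closure_of g ` K False) = {}"
    by blast
  then obtain K where K': "\<forall>p. good (snd p) \<longrightarrow> (\<forall>b. good (K p b) \<and> K p b \<subseteq> snd p \<and> small (fst p) (K p b)) \<and>
      (T closure_of g ` K p True) \<inter> (T closure_of g ` K p False) = {}"
    by (rule choice[THEN exE])
  then have K: "good (K (n, U) b)" "K (n, U) b \<subseteq> U" "small n (K (n, U) b)"
      "(T closure_of g ` K (n, U) True) \<inter> (T closure_of g ` K (n, U) False) = {}"
    if "good U" for n U b
    using that by force+
  obtain U0 where U0: "good U0" "small 0 U0"
    using small_nhd[of "carrier G" \<one> 0] openin_topspace[of T] top by (auto simp: good_def)
  define u where "u = rec_list U0 (\<lambda>b s U. K (Suc (length s), U) b)"
  have u_simps: "u [] = U0" "u (b # s) = K (Suc (length s), u s) b" for b s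
    by (simp_all add: u_def)
  have u: "good (u s) \<and> small (length s) (u s)" for s
    by (induction s) (use U0 K in \<open>auto simp: u_simps\<close>)
  have uG: "u s \<subseteq> carrier G" for s using u[of s] openin_subset top by (auto simp: good_def)
  have udec: "u (b # s) \<subseteq> u s" for b s using K(2) u[of s] by (simp add: u_simps)
  have "\<exists>S\<subseteq>M. subtopology mtopology S homeomorphic_space Cantor_topology"
  proof (rule Cantor_scheme[of "\<lambda>s. g ` u s"])
    show "g ` u (b # s) \<subseteq> g ` u s" for b s using udec by blast
    show "(mtopology closure_of g ` u (True # s)) \<inter> (mtopology closure_of g ` u (False # s)) = {}" for s
      using K(4) u[of s] by (simp add: u_simps T)
    show "d x y < inverse (real (Suc (length s)))" if "x \<in> g ` u s" "y \<in> g ` u s" for s x y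
      using that u[of s] by (auto simp: small_def)
    fix \<alpha>
    have "\<exists>x. \<forall>n. x n \<in> u (branch \<alpha> n)"
      using u by (intro choice) (auto simp: good_def)
    then obtain x where x: "\<And>n. x n \<in> u (branch \<alpha> n)" by blast
    have xN: "x n \<in> u (branch \<alpha> N)" if "n \<ge> N" for n N
      using branch_decreasing[of u N n \<alpha>] udec that x by blast
    have xG: "x n \<in> carrier G" for n using x uG by blast
    have tail: "\<exists>N. \<forall>m\<ge>N. \<forall>n\<ge>N.
        (inv x m \<otimes> x n \<in> O' \<and> x m \<otimes> inv x n \<in> O') \<and>
        (inv h (x m) \<otimes> h (x n) \<in> O' \<and> h (x m) \<otimes> inv h (x n) \<in> O')"
      if O: "openin T O'" "\<one> \<in> O'" for O'
    proof -
      obtain r where r: "r > 0" "mball \<one> r \<subseteq> O'" using O unfolding T openin_mtopology by blast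
      obtain N where "inverse (real (Suc N)) < r" using reals_Archimedean[OF r(1)] by blast
      then have VN: "V N \<subseteq> O'" using r(2) unfolding V_def by (meson mball_subset_concentric less_imp_le subset_trans)
      show ?thesis
      proof (intro exI allI impI)
        fix m n assume "m \<ge> N" "n \<ge> N"
        then have "x m \<in> u (branch \<alpha> N)" "x n \<in> u (branch \<alpha> N)" by (simp_all add: xN)
        then show "(inv x m \<otimes> x n \<in> O' \<and> x m \<otimes> inv x n \<in> O') \<and>
          (inv h (x m) \<otimes> h (x n) \<in> O' \<and> h (x m) \<otimes> inv h (x n) \<in> O')"
          using u[of "branch \<alpha> N"] VN unfolding small_def length_branch by blast
      qed
    qed
    obtain X where X: "X \<in> carrier R" "limitin TR (e \<circ> x) X sequentially"
    proof (rule Raikov_completion_Cauchy_limit[OF tg rc, of x])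
      show "range x \<subseteq> carrier G" using xG by blast
    qed (use tail in meson, use that in blast)
    obtain Y where Y: "Y \<in> carrier R" "limitin TR (e \<circ> (h \<circ> x)) Y sequentially"
    proof (rule Raikov_completion_Cauchy_limit[OF tg rc, of "h \<circ> x"])
      show "range (h \<circ> x) \<subseteq> carrier G" using xG hG by auto
    qed (use tail in \<open>simp, meson\<close>, use that in blast)
    let ?H = "e ` carrier G"
    \<comment> \<open>Continuity of \<open>c\<close> on \<open>G\<close> alone suffices: it is used at the limit only when that limit lies
      in \<open>G\<close>.  Applied to \<open>h\<close> and to its inverse \<open>k\<close>, this shows that \<open>X\<close> and \<open>Y\<close> lie in the same
      coset.\<close>
    have limit_transfer: "B \<in> ?H"
      if A: "A \<in> ?H" "limitin TR (e \<circ> f) A sequentially" and c: "continuous_map T T c"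
        and f: "\<And>n. f n \<in> carrier G" and B: "limitin TR (e \<circ> (c \<circ> f)) B sequentially" for A B c f
    proof -
      obtain a where a: "a \<in> carrier G" "A = e a" using A(1) by blast
      then have "limitin T f a sequentially"
        using A(2) f top limitin_embedding_map_iff[OF emb, of a f] by simp
      then have "limitin T (c \<circ> f) (c a) sequentially" by (rule continuous_map_limit[OF c])
      moreover have ca: "c a \<in> carrier G" using c a top by (auto simp: continuous_map_def)
      moreover have "c (f n) \<in> carrier G" for n using c f top by (auto simp: continuous_map_def)
      ultimately have "limitin TR (e \<circ> (c \<circ> f)) (e (c a)) sequentially"
        using top limitin_embedding_map_iff[OF emb, of "c a" "c \<circ> f"] by simp
      then have "B = e (c a)"
        by (rule limitin_Hausdorff_unique[OF B _ trivial_limit_sequentially HdR])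
      then show ?thesis using ca by blast
    qed
    have XY: "X \<in> ?H \<longleftrightarrow> Y \<in> ?H"
    proof
      assume "X \<in> ?H" then show "Y \<in> ?H" by (rule limit_transfer[OF _ X(2) conth xG Y(2)])
    next
      assume "Y \<in> ?H"
      have "k \<circ> (h \<circ> x) = x" using kh xG by auto
      with \<open>Y \<in> ?H\<close> show "X \<in> ?H"
        using limit_transfer[of Y "h \<circ> x" k X] Y(2) contk xG hG X(2) by simp
    qed
    have subH: "subgroup ?H R" by (rule img_is_subgroup)
    have "inv\<^bsub>R\<^esub> X \<otimes>\<^bsub>R\<^esub> Y \<in> ?H"
    proof (cases "X \<in> ?H")
      case True
      then show ?thesis using XY subH by (meson subgroup.m_closed subgroup.m_inv_closed)
    next
      case False
      then show ?thesis using H.index_two_quotient_mem[OF subH index] X(1) Y(1) XY by blast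
    qed
    then obtain c where c: "c \<in> carrier G" "inv\<^bsub>R\<^esub> X \<otimes>\<^bsub>R\<^esub> Y = e c" by auto
    have "continuous_map (prod_topology TR TR) TR (\<lambda>p. inv\<^bsub>R\<^esub> fst p \<otimes>\<^bsub>R\<^esub> snd p)"
      by (intro topological_group_continuous_ops(1)[OF tgR] continuous_map_fst continuous_map_snd)
    moreover have "limitin (prod_topology TR TR) (\<lambda>n. (e (x n), e (h (x n)))) (X, Y) sequentially"
      using X(2) Y(2) by (simp add: limitin_pairwise o_def)
    ultimately have "limitin TR ((\<lambda>p. inv\<^bsub>R\<^esub> fst p \<otimes>\<^bsub>R\<^esub> snd p) \<circ> (\<lambda>n. (e (x n), e (h (x n))))) (e c) sequentially"
      using continuous_map_limit c(2) by fastforce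
    moreover have "(\<lambda>p. inv\<^bsub>R\<^esub> fst p \<otimes>\<^bsub>R\<^esub> snd p) \<circ> (\<lambda>n. (e (x n), e (h (x n)))) = e \<circ> (g \<circ> x)"
      using xG hG by (auto simp: g_def)
    ultimately have lim: "limitin T (g \<circ> x) c sequentially"
      using limitin_embedding_map_iff[OF emb, of c "g \<circ> x"] c(1) top xG gG by simp
    have "c \<in> T closure_of g ` u (branch \<alpha> N)" for N
    proof (rule limitin_closedin[OF lim closedin_closure_of])
      have "g ` u (branch \<alpha> N) \<subseteq> T closure_of g ` u (branch \<alpha> N)"
        using gG uG top by (intro closure_of_subset) auto
      then show "\<forall>\<^sub>F n in sequentially. (g \<circ> x) n \<in> T closure_of g ` u (branch \<alpha> N)"
        unfolding eventually_sequentially using xN by (intro exI[of _ N]) auto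
    qed simp
    then show "(\<Inter>n. mtopology closure_of g ` u (branch \<alpha> n)) \<noteq> {}" unfolding T by blast
  qed
  then show False using noCantor unfolding T topspace_mtopology by blast
qed

theorem theorem4p4:
  fixes G :: "('a, 'm) monoid_scheme" and T :: "'a topology"
    and R :: "('b, 'n) monoid_scheme" and TR :: "'b topology"
    and e :: "'a \<Rightarrow> 'b"
  assumes "topological_group G T"
    and "separable_space T" and "metrizable_space T"
    and "crowded_space T"
    and "Baire_space T"
    and "countable_dense_homogeneous T"
    and "Raikov_completion G T R TR e"
    and "card (rcosets\<^bsub>R\<^esub> (e ` carrier G)) = 2"
  shows "\<exists>S. S \<subseteq> topspace T \<and> subtopology T S homeomorphic_space Cantor_topology"
proof (rule ccontr)
  assume noCantor: "\<not> ?thesis"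
  have top: "topspace T = carrier G" using assms(1) by (simp add: topological_group_def)
  have "uncountable (carrier G)"
    using crowded_Baire_uncountable[of T] assms(3-5) metrizable_imp_t1_space top by metis
  then obtain D E where DE: "countable_dense_in T D" "countable_dense_in T E"
    and no_translation: "\<And>h U q. homeomorphic_map T T h \<Longrightarrow> h ` D = E \<Longrightarrow> openin T U \<Longrightarrow> U \<noteq> {} \<Longrightarrow>
      q \<in> carrier G \<Longrightarrow> \<exists>x\<in>U. h x \<noteq> x \<otimes>\<^bsub>G\<^esub> q"
    using dense_sets_not_locally_translates[OF assms(1,2)] by metis
  obtain h where h: "homeomorphic_map T T h" "h ` D = E"
    using assms(6) DE unfolding countable_dense_homogeneous_def by blast
  obtain U q where "openin T U" "U \<noteq> {}" "q \<in> carrier G" "\<And>x. x \<in> U \<Longrightarrow> h x = x \<otimes>\<^bsub>G\<^esub> q"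
    using homeomorphism_locally_translation[OF assms(1,3,7,8) noCantor h(1)] by blast
  then show False using no_translation[OF h] by blast
qed

end
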